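(* Let $u\in C^2(\Omega)\cap Lip(\Omega,M)$ and let $\epsilon>0$. Let $x^0\in\Omega$ and let $\alpha^k>0$, $k=0,1,2,\ldots$, be step sizes (the same for all $n$) satisfying $\sum_{m=1}^{K}\alpha^m<1$ for every integer $K>0$. Consider the gradient descent iterates $$x^{k+1}=x^k-\alpha^k\nabla u(x^k)$$ and, for each $n\in\mathbb{N}$, the nonlocal gradient descent iterates $$x^{k+1,n}=x^{k,n}-\alpha^k\nabla_n u(x^{k,n}),\qquad x^{0,n}=x^0,$$ where the initial point and step sizes are such that all iterates $x^k$ and $x^{k,n}$ remain in $\Omega$. Then for each $k$ there is an $N>0$ such that for all $n>N$ we have $\|x^m-x^{m,n}\|<\epsilon$ for $m=1,\ldots,k+1$.
   Context: $\Omega\subset\mathbb{R}^D$ is a bounded, connected, simply connected open set with smooth compact boundary. $\|\cdot\|$ is the Euclidean norm. $Lip(\Omega,M)$ is the set of functions $u:\Omega\to\mathbb{R}$ that are Lipschitz with constant $M$; $C^2(\Omega)$ is the set of twice continuously differentiable functions on $\Omega$. Fix a sequence of radial functions $\rho_n:\mathbb{R}^D\to\mathbb{R}$, $n=1,2,\ldots$ (i.e. $\rho_n(x)=\hat\rho_n(\|x\|)$ for some function $\hat\rho_n$) with $\rho_n\ge 0$, $\int_{\mathbb{R}^D}\rho_n(x)\,dx=1$, and $\lim_{n\to\infty}\int_{\|x\|>\delta}\rho_n(x)\,dx=0$ for all $\delta>0$. The nonlocal gradient at scale $n$ is $$\nabla_n u(x)=D\int_\Omega \frac{u(x)-u(y)}{\|x-y\|}\,\frac{x-y}{\|x-y\|}\,\rho_n(x-y)\,dy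 ,$$ which converges absolutely for Lipschitz $u$. *)

theory Defs
  imports "HOL-Analysis.Analysis"
begin

text \<open>Meant for open \<open>S\<close>: all iterated partial derivatives of order at most \<open>k\<close>
  exist and are continuous on \<open>S\<close>. Values of \<open>f\<close> outside \<open>S\<close> are irrelevant there.\<close>

primrec Ck_on :: "nat \<Rightarrow> 'a::euclidean_space set \<Rightarrow> ('a \<Rightarrow> real) \<Rightarrow> bool" where
  "Ck_on 0 S f \<longleftrightarrow> continuous_on S f"
| "Ck_on (Suc k) S f \<longleftrightarrow>
     (\<forall>x\<in>S. f differentiable (at x)) \<and>
     (\<forall>i\<in>Basis. Ck_on k S (\<lambda>x. frechet_derivative f (at x) i))"

definition smooth_on :: "'a::euclidean_space set \<Rightarrow> ('a \<Rightarrow> real) \<Rightarrow> bool" where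
  "smooth_on S f \<longleftrightarrow> (\<forall>k. Ck_on k S f)"

text \<open>Arbitrary value at points where \<open>f\<close> is not differentiable.\<close>

definition grad :: "('a::euclidean_space \<Rightarrow> real) \<Rightarrow> 'a \<Rightarrow> 'a" where
  "grad f x = (THE d. GDERIV f x :> d)"

lemma grad_eqI: "GDERIV f x :> d \<Longrightarrow> grad f x = d"
  unfolding grad_def
proof (rule the_equality)
  fix e assume "GDERIV f x :> d" "GDERIV f x :> e"
  then have "(\<lambda>h. h \<bullet> e) = (\<lambda>h. h \<bullet> d)"
    unfolding gderiv_def by (rule has_derivative_unique[rotated])
  then show "e = d"
    by (metis inner_commute vector_eq_ldot)
qed

text \<open>Near each boundary point the set is the strict sublevel set of a smooth function
  with nonvanishing gradient; so the boundary is a smooth hypersurface with the set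
  locally on one side of it.\<close>

definition smooth_boundary :: "'a::euclidean_space set \<Rightarrow> bool" where
  "smooth_boundary S \<longleftrightarrow>
     (\<forall>p\<in>frontier S. \<exists>U \<phi>. open U \<and> p \<in> U \<and> smooth_on U \<phi> \<and>
        (\<forall>x\<in>U. grad \<phi> x \<noteq> 0) \<and> S \<inter> U = {x\<in>U. \<phi> x < 0})"

definition radial :: "('a::real_normed_vector \<Rightarrow> real) \<Rightarrow> bool" where
  "radial f \<longleftrightarrow> (\<exists>h. \<forall>x. f x = h (norm x))"

text \<open>The integrand is \<open>0\<close> at \<open>y = x\<close> by the convention on division by zero;
  this single point does not affect the integral.\<close>

definition nonlocal_grad ::
  "'a::euclidean_space set \<Rightarrow> ('a \<Rightarrow> real) \<Rightarrow> ('a \<Rightarrow> real) \<Rightarrow> 'a \<Rightarrow> 'a" where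
  "nonlocal_grad \<Omega> \<rho> u x =
     real DIM('a) *\<^sub>R
       (LINT y:\<Omega>|lebesgue.
          ((u x - u y) / norm (x - y) * \<rho> (x - y)) *\<^sub>R ((x - y) /\<^sub>R norm (x - y)))"

end

theory Submission
  imports Defs
begin

text \<open>On a radial density of mass \<open>m\<close> the second moments of \<open>w / norm w\<close> are \<open>m / D\<close> times the
  identity matrix, so the nonlocal gradient of a linear function over the whole space is its
  gradient. Since \<open>u\<close> is strictly differentiable, replacing \<open>u\<close> by its linearisation at a limit
  point \<open>p\<close> costs little on a ball whose radius is uniform in the centre near \<open>p\<close>; off this ball
  the integrand is bounded and the mass of \<open>\<rho>\<^sub>n\<close> vanishes. Hence nonlocal gradients at points
  converging to \<open>p\<close> converge to the gradient at \<open>p\<close>, and the iterates converge by induction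
  on the step.\<close>

section \<open>Measure-preserving maps and Lebesgue integrals\<close>

text \<open>Box and affine formulas concern \<open>lborel\<close>, whereas the densities are only
  Lebesgue measurable, so invariance has to pass to the completion. A map that preserves
  \<open>lborel\<close> pulls null sets back to null sets, which keeps it measurable once both sides
  are completed.\<close>

lemma lebesgue_distr_eqI:
  fixes T :: "'a::euclidean_space \<Rightarrow> 'a"
  assumes T: "T \<in> borel \<rightarrow>\<^sub>M borel" and eq: "distr lborel borel T = lborel"
  shows "T \<in> lebesgue \<rightarrow>\<^sub>M lebesgue" and "distr lebesgue lebesgue T = lebesgue"
proof -
  have Tl: "T \<in> lborel \<rightarrow>\<^sub>M lborel"
    using T by simp
  have d: "distr lebesgue lborel T = lborel"
    using distr_completion[OF Tl] eq by (simp add: cong: distr_cong)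
  then show "T \<in> lebesgue \<rightarrow>\<^sub>M lebesgue"
    using Tl by (simp add: completion.measurable_completion2 measurable_completion)
  have "completion (distr lebesgue lborel T) = distr lebesgue (completion lborel) T"
    by (rule completion.completion_distr_eq) (use Tl d in \<open>auto simp: measurable_completion\<close>)
  then show "distr lebesgue lebesgue T = lebesgue"
    by (simp add: d)
qed

lemma lebesgue_integral_distr_eq:
  fixes T :: "'a::euclidean_space \<Rightarrow> 'a" and f :: "'a \<Rightarrow> 'b::{banach, second_countable_topology}"
  assumes T: "T \<in> borel \<rightarrow>\<^sub>M borel" and eq: "distr lborel borel T = lborel"
    and f: "f \<in> borel_measurable lebesgue"
  shows "(LINT x|lebesgue. f (T x)) = (LINT x|lebesgue. f x)"
  using integral_distr[OF lebesgue_distr_eqI(1)[OF T eq] f] lebesgue_distr_eqI(2)[OF T eq] by simp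

text \<open>The affine map scales volume by the product of the \<open>\<bar>c j\<bar>\<close>, which
  is one. Flipping one coordinate serves to kill mixed moments; flipping all of them gives the
  substitution \<open>y = t - x\<close>.\<close>

lemma lebesgue_integral_sign_change:
  fixes f :: "'a::euclidean_space \<Rightarrow> 'b::{banach, second_countable_topology}" and c :: "'a \<Rightarrow> real"
  assumes f: "f \<in> borel_measurable lebesgue" and c: "\<And>j. j \<in> Basis \<Longrightarrow> \<bar>c j\<bar> = 1"
  shows "(LINT x|lebesgue. f (t + (\<Sum>j\<in>Basis. (c j * (x \<bullet> j)) *\<^sub>R j))) = (LINT x|lebesgue. f x)"
proof (rule lebesgue_integral_distr_eq[OF _ _ f])
  let ?T = "\<lambda>x::'a. t + (\<Sum>j\<in>Basis. (c j * (x \<bullet> j)) *\<^sub>R j)"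
  have "lborel = density (distr lborel borel ?T) (\<lambda>_. (\<Prod>j\<in>Basis. \<bar>c j\<bar>))"
    using c by (intro lborel_affine_euclidean) force
  then show "distr lborel borel ?T = lborel"
    using c by (simp add: density_1)
qed simp

lemma lebesgue_integral_reflect:
  fixes f :: "'a::euclidean_space \<Rightarrow> 'b::{banach, second_countable_topology}"
  assumes "f \<in> borel_measurable lebesgue"
  shows "(LINT x|lebesgue. f (t - x)) = (LINT x|lebesgue. f x)"
  using lebesgue_integral_sign_change[OF assms, of "\<lambda>_. -1" t]
  by (simp add: sum_negf euclidean_representation)

text \<open>Since \<open>\<sigma>\<close> is an involution of the basis, the preimage of a box is
  the box with both corners permuted. Its edge lengths are the old ones in another order, and the
  measures of boxes determine \<open>lborel\<close>.\<close>

lemma lebesgue_integral_permute_basis: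
  fixes f :: "'a::euclidean_space \<Rightarrow> 'b::{banach, second_countable_topology}" and \<sigma> :: "'a \<Rightarrow> 'a"
  assumes f: "f \<in> borel_measurable lebesgue"
    and \<sigma>: "\<And>b. b \<in> Basis \<Longrightarrow> \<sigma> b \<in> Basis" "\<And>b. b \<in> Basis \<Longrightarrow> \<sigma> (\<sigma> b) = b"
  shows "(LINT x|lebesgue. f (\<Sum>b\<in>Basis. (x \<bullet> \<sigma> b) *\<^sub>R b)) = (LINT x|lebesgue. f x)"
proof (rule lebesgue_integral_distr_eq[OF _ _ f])
  let ?T = "\<lambda>x::'a. \<Sum>b\<in>Basis. (x \<bullet> \<sigma> b) *\<^sub>R b"
  have T_inner: "?T x \<bullet> b = x \<bullet> \<sigma> b" if "b \<in> Basis" for x b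
    using that by simp
  have bij: "bij_betw \<sigma> Basis Basis"
    by (rule bij_betw_byWitness[of _ \<sigma>]) (use \<sigma> in auto)
  have vim: "?T -` box l u = box (?T l) (?T u)" for l u
  proof -
    have "(\<forall>b\<in>Basis. l \<bullet> b < x \<bullet> \<sigma> b \<and> x \<bullet> \<sigma> b < u \<bullet> b) \<longleftrightarrow>
        (\<forall>b\<in>Basis. l \<bullet> \<sigma> b < x \<bullet> b \<and> x \<bullet> b < u \<bullet> \<sigma> b)" for x
      using \<sigma> by metis
    then show ?thesis
      by (auto simp: box_def)
  qed
  show "distr lborel borel ?T = lborel"
  proof (rule lborel_eqI[symmetric])
    fix l u :: 'a
    assume le: "\<And>b. b \<in> Basis \<Longrightarrow> l \<bullet> b \<le> u \<bullet> b"
    have "emeasure (distr lborel borel ?T) (box l u) = emeasure lborel (box (?T l) (?T u))"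
      by (subst emeasure_distr) (auto simp: vim)
    also have "\<dots> = (\<Prod>b\<in>Basis. (?T u - ?T l) \<bullet> b)"
      using le \<sigma>(1) by (simp only: emeasure_lborel_box T_inner)
    also have "\<dots> = (\<Prod>b\<in>Basis. (u - l) \<bullet> \<sigma> b)"
      by (simp add: inner_diff_left)
    also have "\<dots> = (\<Prod>b\<in>Basis. (u - l) \<bullet> b)"
      using prod.reindex_bij_betw[OF bij, of "\<lambda>b. (u - l) \<bullet> b"] by simp
    finally show "emeasure (distr lborel borel ?T) (box l u) = (\<Prod>b\<in>Basis. (u - l) \<bullet> b)" .
  qed simp
qed simp

section \<open>Second moments of radial densities\<close>

lemma integrable_mult_unit_bounded:
  fixes f h :: "'a::euclidean_space \<Rightarrow> real"
  assumes "integrable lebesgue f" "h \<in> borel_measurable lebesgue" "\<And>w. \<bar>h w\<bar> \<le> 1"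
  shows "integrable lebesgue (\<lambda>w. f w * h w)"
  using assms(1)
proof (rule Bochner_Integration.integrable_bound)
  show "(\<lambda>w. f w * h w) \<in> borel_measurable lebesgue"
    using assms by measurable
  show "AE w in lebesgue. norm (f w * h w) \<le> norm (f w)"
    by (intro AE_I2) (use assms(3) in \<open>auto simp: abs_mult intro: mult_left_le\<close>)
qed

lemma abs_sgn_inner_Basis_le: "i \<in> Basis \<Longrightarrow> \<bar>sgn w \<bullet> i\<bar> \<le> 1" for w :: "'a::euclidean_space"
  using Basis_le_norm[of i "sgn w"] by (auto simp: norm_sgn split: if_splits)

lemma measurable_sgn_inner [measurable]:
  "(\<lambda>w::'a::euclidean_space. sgn w \<bullet> i) \<in> borel_measurable lebesgue"
proof -
  have "(\<lambda>w::'a. sgn w \<bullet> i) \<in> borel_measurable borel"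
    unfolding sgn_div_norm by measurable
  then show ?thesis
    by (simp add: measurable_completion)
qed

lemma norm_eq_sqrt_sum_Basis: "norm w = sqrt (\<Sum>b\<in>Basis. (w \<bullet> b)\<^sup>2)"
  for w :: "'a::euclidean_space"
  by (subst norm_eq_sqrt_inner, subst euclidean_inner) (simp only: power2_eq_square)

lemma norm_permute_basis:
  fixes w :: "'a::euclidean_space"
  assumes \<sigma>: "\<And>b. b \<in> Basis \<Longrightarrow> \<sigma> b \<in> Basis" "\<And>b. b \<in> Basis \<Longrightarrow> \<sigma> (\<sigma> b) = b"
  shows "norm (\<Sum>b\<in>Basis. (w \<bullet> \<sigma> b) *\<^sub>R b) = norm w"
proof -
  have bij: "bij_betw \<sigma> Basis Basis"
    by (rule bij_betw_byWitness[of _ \<sigma>]) (use \<sigma> in auto)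
  show ?thesis
    using sum.reindex_bij_betw[OF bij, of "\<lambda>b. (w \<bullet> b)\<^sup>2"]
    by (simp add: norm_eq_sqrt_sum_Basis)
qed

lemma norm_sign_change:
  fixes w :: "'a::euclidean_space"
  assumes "\<And>j. j \<in> Basis \<Longrightarrow> \<bar>c j\<bar> = 1"
  shows "norm (\<Sum>j\<in>Basis. (c j * (w \<bullet> j)) *\<^sub>R j) = norm w"
proof -
  have "(c j * (w \<bullet> j))\<^sup>2 = (w \<bullet> j)\<^sup>2" if "j \<in> Basis" for j
    using assms[OF that] by (metis abs_mult mult_1 power2_abs)
  then show ?thesis
    by (simp add: norm_eq_sqrt_sum_Basis)
qed

text \<open>The off-diagonal second moments vanish by reflecting one coordinate; the diagonal ones agree
  by swapping two coordinates, and they add up to the total mass.\<close>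

lemma radial_second_moment:
  fixes f :: "'a::euclidean_space \<Rightarrow> real"
  assumes rad: "radial f" and int: "integrable lebesgue f" and i: "i \<in> Basis" and j: "j \<in> Basis"
  shows "(LINT w|lebesgue. f w * ((sgn w \<bullet> i) * (sgn w \<bullet> j))) =
    (if i = j then (LINT w|lebesgue. f w) / DIM('a) else 0)"
proof -
  obtain h where h: "\<And>x. f x = h (norm x)"
    using rad by (auto simp: radial_def)
  define m where "m i j = (\<lambda>w. f w * ((sgn w \<bullet> i) * (sgn w \<bullet> j)))" for i j :: 'a
  have [measurable]: "f \<in> borel_measurable lebesgue"
    using int by (rule borel_measurable_integrable)
  have m_meas: "m i j \<in> borel_measurable lebesgue" for i j
    unfolding m_def by measurable
  have m_int: "integrable lebesgue (m i j)" if "i \<in> Basis" "j \<in> Basis" for i j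
    unfolding m_def
    using abs_sgn_inner_Basis_le[OF that(1)] abs_sgn_inner_Basis_le[OF that(2)]
    by (intro integrable_mult_unit_bounded[OF int]) (auto simp: abs_mult intro: mult_le_one)
  have diag: "(LINT w|lebesgue. m b b w) = (LINT w|lebesgue. m i i w)" if b: "b \<in> Basis" for b
  proof -
    define \<sigma> where "\<sigma> = Transposition.transpose i b"
    have \<sigma>: "\<And>b. b \<in> Basis \<Longrightarrow> \<sigma> b \<in> Basis" "\<And>b. b \<in> Basis \<Longrightarrow> \<sigma> (\<sigma> b) = b"
      using i b by (auto simp: \<sigma>_def Transposition.transpose_def)
    let ?T = "\<lambda>w::'a. \<Sum>b\<in>Basis. (w \<bullet> \<sigma> b) *\<^sub>R b"
    have "m i i (?T w) = m b b w" for w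
      using norm_permute_basis[OF \<sigma>, of w] i
      by (simp add: m_def h sgn_div_norm) (simp add: \<sigma>_def)
    then show ?thesis
      using lebesgue_integral_permute_basis[OF m_meas \<sigma>, of i i] by simp
  qed
  show ?thesis
  proof (cases "i = j")
    case False
    define c where "c b = (if b = i then -1 else 1 :: real)" for b
    have c: "\<bar>c b\<bar> = 1" for b
      by (simp add: c_def)
    let ?T = "\<lambda>w::'a. \<Sum>b\<in>Basis. (c b * (w \<bullet> b)) *\<^sub>R b"
    have "m i j (?T w) = - m i j w" for w
      using norm_sign_change[of c w, OF c] False i j
      by (simp add: m_def h sgn_div_norm) (simp add: c_def)
    then have "(LINT w|lebesgue. m i j w) = 0"
      using lebesgue_integral_sign_change[where f = "m i j" and c = c and t = 0, OF m_meas] c by simp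
    then show ?thesis
      using False by (simp add: m_def)
  next
    case True
    have "(LINT w|lebesgue. f w) = (LINT w|lebesgue. (\<Sum>b\<in>Basis. m b b w))"
    proof (rule integral_cong_AE)
      \<comment> \<open>The squared coordinates of \<open>sgn w\<close> add up to one except at the
        origin, where \<open>sgn\<close> is zero; hence equality only almost everywhere.\<close>
      have "(\<Sum>b\<in>Basis. m b b w) = f w * (sgn w \<bullet> sgn w)" for w
        by (simp add: m_def euclidean_inner[of "sgn w" "sgn w"] sum_distrib_left)
      then have "f w = (\<Sum>b\<in>Basis. m b b w)" if "w \<noteq> 0" for w
        using that by (simp add: dot_square_norm norm_sgn)
      moreover have "AE w in lebesgue. w \<noteq> (0::'a)"
        by (simp add: AE_completion AE_lborel_singleton)
      ultimately show "AE w in lebesgue. f w = (\<Sum>b\<in>Basis. m b b w)"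
        by (auto elim: eventually_mono)
    qed (use m_meas in auto)
    also have "\<dots> = (\<Sum>b\<in>Basis. LINT w|lebesgue. m b b w)"
      using m_int by (intro Bochner_Integration.integral_sum) auto
    also have "\<dots> = DIM('a) * (LINT w|lebesgue. m i i w)"
      using diag by (simp add: sum.cong)
    finally show ?thesis
      using True by (simp add: m_def)
  qed
qed

lemma measurable_sgn_lebesgue [measurable]:
  "(sgn :: 'a::euclidean_space \<Rightarrow> 'a) \<in> borel_measurable lebesgue"
  by (subst borel_measurable_euclidean_space) auto

text \<open>Each coordinate of the integral expands into second moments weighted by the coordinates
  of \<open>g\<close>, of which only the diagonal one survives. For mass one the result is
  \<open>g\<close> divided by the dimension, which the factor in \<open>nonlocal_grad\<close>
  cancels.\<close>

lemma radial_moment: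
  fixes f :: "'a::euclidean_space \<Rightarrow> real"
  assumes rad: "radial f" and int: "integrable lebesgue f"
  shows "integrable lebesgue (\<lambda>w. (f w * (g \<bullet> sgn w)) *\<^sub>R sgn w)"
    and "(LINT w|lebesgue. (f w * (g \<bullet> sgn w)) *\<^sub>R sgn w) = ((LINT w|lebesgue. f w) / DIM('a)) *\<^sub>R g"
proof -
  have [measurable]: "f \<in> borel_measurable lebesgue"
    using int by (rule borel_measurable_integrable)
  show I: "integrable lebesgue (\<lambda>w. (f w * (g \<bullet> sgn w)) *\<^sub>R sgn w)"
  proof (rule Bochner_Integration.integrable_bound)
    show "integrable lebesgue (\<lambda>w. norm g * f w)"
      using int by simp
    have "norm ((f w * (g \<bullet> sgn w)) *\<^sub>R sgn w) \<le> norm (norm g * f w)" for w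
    proof -
      have "\<bar>g \<bullet> sgn w\<bar> * norm (sgn w) \<le> norm g"
        using Cauchy_Schwarz_ineq2[of g "sgn w"] by (auto simp: norm_sgn split: if_splits)
      then show ?thesis
        using mult_right_mono[of "\<bar>g \<bullet> sgn w\<bar> * norm (sgn w)" "norm g" "\<bar>f w\<bar>"]
        by (simp add: abs_mult mult_ac)
    qed
    then show "AE w in lebesgue. norm ((f w * (g \<bullet> sgn w)) *\<^sub>R sgn w) \<le> norm (norm g * f w)"
      by simp
  qed measurable
  show "(LINT w|lebesgue. (f w * (g \<bullet> sgn w)) *\<^sub>R sgn w) = ((LINT w|lebesgue. f w) / DIM('a)) *\<^sub>R g"
  proof (rule euclidean_eqI)
    fix j :: 'a assume j: "j \<in> Basis"
    have mi: "integrable lebesgue (\<lambda>w. f w * ((sgn w \<bullet> i) * (sgn w \<bullet> j)))" if "i \<in> Basis" for i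
      using abs_sgn_inner_Basis_le[OF that] abs_sgn_inner_Basis_le[OF j]
      by (intro integrable_mult_unit_bounded[OF int]) (auto simp: abs_mult intro: mult_le_one)
    have "(LINT w|lebesgue. (f w * (g \<bullet> sgn w)) *\<^sub>R sgn w) \<bullet> j
        = (LINT w|lebesgue. ((f w * (g \<bullet> sgn w)) *\<^sub>R sgn w) \<bullet> j)"
      by (rule integral_inner_left[symmetric]) (rule I)
    also have "\<dots> = (LINT w|lebesgue. (\<Sum>i\<in>Basis. (g \<bullet> i) * (f w * ((sgn w \<bullet> i) * (sgn w \<bullet> j)))))"
    proof (rule Bochner_Integration.integral_cong[OF refl])
      fix w :: 'a
      show "((f w * (g \<bullet> sgn w)) *\<^sub>R sgn w) \<bullet> j =
          (\<Sum>i\<in>Basis. (g \<bullet> i) * (f w * ((sgn w \<bullet> i) * (sgn w \<bullet> j))))"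
        by (simp add: euclidean_inner[of g "sgn w"] sum_distrib_left sum_distrib_right mult_ac)
    qed
    also have "\<dots> = (\<Sum>i\<in>Basis. (g \<bullet> i) * (LINT w|lebesgue. f w * ((sgn w \<bullet> i) * (sgn w \<bullet> j))))"
      using mi by (subst Bochner_Integration.integral_sum) auto
    also have "\<dots> = (\<Sum>i\<in>Basis. if i = j then (g \<bullet> i) * ((LINT w|lebesgue. f w) / DIM('a)) else 0)"
      by (intro sum.cong) (auto simp: radial_second_moment[OF rad int _ j])
    also have "\<dots> = ((LINT w|lebesgue. f w) / DIM('a)) *\<^sub>R g \<bullet> j"
      using j by simp
    finally show "(LINT w|lebesgue. (f w * (g \<bullet> sgn w)) *\<^sub>R sgn w) \<bullet> j
        = ((LINT w|lebesgue. f w) / DIM('a)) *\<^sub>R g \<bullet> j" .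
  qed
qed

section \<open>Gradients and strict differentiability\<close>

lemma Ck_on_imp_continuous_on: "Ck_on k S f \<Longrightarrow> continuous_on S f"
  by (cases k)
    (auto intro!: continuous_at_imp_continuous_on differentiable_imp_continuous_within)

text \<open>By linearity the derivative is the inner product with the vector of partial derivatives,
  whose coordinates are continuous because they are \<open>Ck_on k S\<close>. Uniqueness of the
  gradient identifies this vector with \<open>grad f x\<close>.\<close>

lemma Ck_on_Suc_grad:
  fixes f :: "'a::euclidean_space \<Rightarrow> real"
  assumes "Ck_on (Suc k) S f"
  shows "\<And>x. x \<in> S \<Longrightarrow> GDERIV f x :> grad f x" and "continuous_on S (grad f)"
proof -
  let ?G = "\<lambda>x. \<Sum>i\<in>Basis. frechet_derivative f (at x) i *\<^sub>R i"
  have G: "GDERIV f x :> ?G x" if "x \<in> S" for x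
  proof -
    have D: "(f has_derivative frechet_derivative f (at x)) (at x)"
      using assms that by (simp add: frechet_derivative_works)
    then interpret bounded_linear "frechet_derivative f (at x)"
      by (rule has_derivative_bounded_linear)
    have "frechet_derivative f (at x) h = h \<bullet> ?G x" for h
    proof -
      have "frechet_derivative f (at x) h = frechet_derivative f (at x) (\<Sum>i\<in>Basis. (h \<bullet> i) *\<^sub>R i)"
        by (simp add: euclidean_representation)
      also have "\<dots> = h \<bullet> ?G x"
        by (simp add: sum scale inner_sum_right mult.commute)
      finally show ?thesis .
    qed
    then have "frechet_derivative f (at x) = (\<lambda>h. h \<bullet> ?G x)"
      by (rule ext)
    with D show ?thesis
      by (simp add: gderiv_def)
  qed
  have eq: "grad f x = ?G x" if "x \<in> S" for x
    using grad_eqI[OF G[OF that]] .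
  show "GDERIV f x :> grad f x" if "x \<in> S" for x
    using G[OF that] eq[OF that] by simp
  have "continuous_on S ?G"
    using assms by (auto intro!: continuous_intros Ck_on_imp_continuous_on)
  then show "continuous_on S (grad f)"
    by (simp add: eq cong: continuous_on_cong)
qed

text \<open>The mean value inequality is applied to \<open>f\<close> minus its linear part at
  \<open>z\<close>: on a small ball, which is convex, the gradient of the difference has norm at
  most \<eta> by continuity of \<open>G\<close>. Both points may vary, which is what moving centres
  call for.\<close>

lemma C1_strictly_differentiable:
  fixes f :: "'a::euclidean_space \<Rightarrow> real"
  assumes "open S" "z \<in> S" and der: "\<And>x. x \<in> S \<Longrightarrow> GDERIV f x :> G x"
    and cont: "continuous_on S G" and "\<eta> > 0"
  obtains \<delta> where "\<delta> > 0" "ball z \<delta> \<subseteq> S"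
    "\<And>x y. x \<in> ball z \<delta> \<Longrightarrow> y \<in> ball z \<delta> \<Longrightarrow> \<bar>f x - f y - G z \<bullet> (x - y)\<bar> \<le> \<eta> * norm (x - y)"
proof -
  obtain \<delta>1 where "\<delta>1 > 0" and \<delta>1: "ball z \<delta>1 \<subseteq> S"
    using assms(1,2) by (auto simp: open_contains_ball)
  obtain \<delta>2 where "\<delta>2 > 0" and \<delta>2: "\<And>x. x \<in> S \<Longrightarrow> dist x z < \<delta>2 \<Longrightarrow> dist (G x) (G z) < \<eta>"
    using cont[unfolded continuous_on_iff] \<open>z \<in> S\<close> \<open>\<eta> > 0\<close> by meson
  define \<delta> where "\<delta> = min \<delta>1 \<delta>2"
  show thesis
  proof
    show "\<delta> > 0" "ball z \<delta> \<subseteq> S"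
      using \<open>\<delta>1 > 0\<close> \<open>\<delta>2 > 0\<close> \<delta>1 by (auto simp: \<delta>_def)
    then have sub: "x \<in> S" if "x \<in> ball z \<delta>" for x
      using that by auto
    fix x y assume xy: "x \<in> ball z \<delta>" "y \<in> ball z \<delta>"
    have "norm ((f x - G z \<bullet> x) - (f y - G z \<bullet> y)) \<le> \<eta> * norm (x - y)"
    proof (rule differentiable_bound[OF convex_ball _ _ xy])
      fix w assume w: "w \<in> ball z \<delta>"
      show "((\<lambda>w. f w - G z \<bullet> w) has_derivative (\<lambda>h. h \<bullet> G w - G z \<bullet> h)) (at w within ball z \<delta>)"
        using has_derivative_at_withinI[OF der[OF sub[OF w], unfolded gderiv_def]]
        by (intro derivative_intros)
      have "norm (G w - G z) \<le> \<eta>"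
        using \<delta>2[OF sub[OF w]] w by (simp add: \<delta>_def dist_commute flip: dist_norm)
      then have "norm (h \<bullet> G w - G z \<bullet> h) \<le> \<eta> * norm h" for h
        using Cauchy_Schwarz_ineq2[of h "G w - G z"] mult_right_mono[of "norm (G w - G z)" \<eta> "norm h"]
        by (simp add: inner_diff_right inner_commute[of "G z"] mult.commute)
      then show "onorm (\<lambda>h. h \<bullet> G w - G z \<bullet> h) \<le> \<eta>"
        by (rule onorm_le)
    qed
    then show "\<bar>f x - f y - G z \<bullet> (x - y)\<bar> \<le> \<eta> * norm (x - y)"
      by (simp add: inner_diff_right algebra_simps)
  qed
qed

section \<open>Convergence of nonlocal gradients\<close>

text \<open>The integrand is compared with that of the linear function with gradient
  \<open>g\<close> over the whole space, whose integral is known exactly. Up to distance \<delta>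
  the linearisation error costs at most \<eta> times the density; farther out the two difference
  quotients are merely bounded, by \<open>M\<close> and \<open>norm g\<close>, and only the tail
  mass counts.\<close>

lemma nonlocal_grad_error_bound:
  fixes u :: "'a::euclidean_space \<Rightarrow> real"
  assumes \<Omega>: "open \<Omega>" and lip: "M-lipschitz_on \<Omega> u"
    and rad: "radial \<rho>" and nonneg: "\<And>w. \<rho> w \<ge> 0" and int: "integrable lebesgue \<rho>"
    and mass: "(LINT w|lebesgue. \<rho> w) = 1"
    and z: "z \<in> \<Omega>" and "\<eta> \<ge> 0" and sub: "cball z \<delta> \<subseteq> \<Omega>"
    and lin: "\<And>y. y \<in> cball z \<delta> \<Longrightarrow> \<bar>u z - u y - g \<bullet> (z - y)\<bar> \<le> \<eta> * norm (z - y)"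
  shows "norm (nonlocal_grad \<Omega> \<rho> u z - g) \<le>
    DIM('a) * (\<eta> + (M + norm g) * (LINT w:{w. norm w > \<delta>}|lebesgue. \<rho> w))"
proof -
  have M: "M \<ge> 0"
    using lip by (rule lipschitz_on_nonneg)
  have [measurable]: "\<rho> \<in> borel_measurable lebesgue"
    using int by (rule borel_measurable_integrable)
  \<comment> \<open>The increment of \<open>u\<close> in terms of the displacement
    \<open>w = z - y\<close>, cut off outside \<open>\<Omega>\<close> so that the set integral
    becomes one over the whole space.\<close>
  define q where "q w = indicator \<Omega> (z - w) *\<^sub>R (u z - u (z - w))" for w
  \<comment> \<open>Continuity is known on the open set \<open>\<Omega>\<close> only; multiplying by
    its indicator gives a Borel function everywhere.\<close>
  have "(\<lambda>y. indicator \<Omega> y *\<^sub>R (u z - u y)) \<in> borel_measurable borel"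
    using \<Omega> lipschitz_on_continuous_on[OF lip]
    by (intro borel_measurable_continuous_on_indicator) (auto intro!: continuous_intros)
  then have "q \<in> borel_measurable borel"
    unfolding q_def[abs_def] by (rule measurable_compose[rotated]) simp
  then have [measurable]: "q \<in> borel_measurable lebesgue"
    by (simp add: measurable_completion)
  have q_le: "\<bar>q w\<bar> \<le> M * norm w" for w
    using lipschitz_onD[OF lip z, of "z - w"] M by (auto simp: q_def indicator_def dist_norm)
  have q_lin: "\<bar>q w - g \<bullet> w\<bar> \<le> \<eta> * norm w" if "norm w \<le> \<delta>" for w
  proof -
    have "z - w \<in> cball z \<delta>"
      using that by (simp add: dist_norm)
    with sub have "z - w \<in> \<Omega>" "\<bar>u z - u (z - w) - g \<bullet> w\<bar> \<le> \<eta> * norm w"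
      using lin[of "z - w"] by auto
    then show ?thesis
      by (simp add: q_def)
  qed
  define t where "t = indicat_real {w::'a. norm w > \<delta>}"
  have [measurable]: "t \<in> borel_measurable lebesgue"
    unfolding t_def by (simp add: measurable_completion)
  \<comment> \<open>\<open>F\<close> is the nonlocal integrand in the variable \<open>w\<close>;
    \<open>E\<close> is its analogue for the linear function, without cutoff.\<close>
  define F where "F w = (q w / norm w * \<rho> w) *\<^sub>R sgn w" for w
  define E where "E w = (\<rho> w * (g \<bullet> sgn w)) *\<^sub>R sgn w" for w
  have [measurable]: "(norm :: 'a \<Rightarrow> real) \<in> borel_measurable lebesgue"
    by (simp add: measurable_completion)
  have [measurable]: "F \<in> borel_measurable lebesgue"
    unfolding F_def by measurable
  have E_int: "integrable lebesgue E" and E_eq: "(LINT w|lebesgue. E w) = (1 / DIM('a)) *\<^sub>R g"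
    unfolding E_def using radial_moment[OF rad int, of g] mass by auto
  have bound: "norm (F w - E w) \<le> \<eta> * \<rho> w + (M + norm g) * (t w * \<rho> w)" for w
  proof (cases "w = 0")
    \<comment> \<open>At the origin \<open>sgn\<close> is zero, so \<open>F\<close> and
      \<open>E\<close> both vanish.\<close>
    case True
    then show ?thesis
      using nonneg[of 0] \<open>\<eta> \<ge> 0\<close> M by (simp add: F_def E_def t_def)
  next
    case False
    have "F w - E w = (\<rho> w * ((q w - g \<bullet> w) / norm w)) *\<^sub>R sgn w"
    proof -
      have "q w / norm w * \<rho> w - \<rho> w * (g \<bullet> sgn w) = \<rho> w * ((q w - g \<bullet> w) / norm w)"
        by (simp add: sgn_div_norm divide_inverse algebra_simps)
      then show ?thesis
        by (simp only: F_def E_def scaleR_diff_left[symmetric])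
    qed
    then have "norm (F w - E w) = \<rho> w * (\<bar>q w - g \<bullet> w\<bar> / norm w)"
      using False nonneg[of w] by (simp add: abs_mult norm_sgn)
    also have "\<dots> \<le> \<rho> w * (\<eta> + (M + norm g) * t w)"
    proof (rule mult_left_mono[OF _ nonneg])
      have "\<bar>q w - g \<bullet> w\<bar> \<le> (\<eta> + (M + norm g) * t w) * norm w"
      proof (cases "norm w \<le> \<delta>")
        case True
        then show ?thesis
          using q_lin[of w] by (simp add: t_def)
      next
        case False
        \<comment> \<open>Here \<open>t w = 1\<close>; the \<eta> term is mere slack on top of the
          crude bounds \<open>M * norm w\<close> and \<open>norm g * norm w\<close>.\<close>
        have "0 \<le> \<eta> * norm w"
          using \<open>\<eta> \<ge> 0\<close> by simp
        with False show ?thesis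
          using q_le[of w] Cauchy_Schwarz_ineq2[of g w] by (simp add: t_def algebra_simps)
      qed
      then show "\<bar>q w - g \<bullet> w\<bar> / norm w \<le> \<eta> + (M + norm g) * t w"
        using False by (simp add: divide_le_eq)
    qed
    finally show ?thesis
      by (simp add: algebra_simps)
  qed
  have t\<rho>_int: "integrable lebesgue (\<lambda>w. t w * \<rho> w)"
    using integrable_mult_unit_bounded[OF int, of t] by (simp add: t_def mult.commute)
  then have B_int: "integrable lebesgue (\<lambda>w. \<eta> * \<rho> w + (M + norm g) * (t w * \<rho> w))"
    using int by simp
  \<comment> \<open>Integrability of \<open>F\<close> is inherited from \<open>E\<close>, as the
    difference is dominated by \<open>bound\<close>.\<close>
  have FE_int: "integrable lebesgue (\<lambda>w. F w - E w)"
    by (rule Bochner_Integration.integrable_bound[OF B_int])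
      (use bound E_int in \<open>auto intro!: AE_I2 order_trans[OF _ abs_ge_self]\<close>)
  have F_int: "integrable lebesgue F"
    using Bochner_Integration.integrable_add[OF FE_int E_int] by simp
  have "indicat_real \<Omega> y *\<^sub>R ((u z - u y) / norm (z - y) * \<rho> (z - y)) *\<^sub>R ((z - y) /\<^sub>R norm (z - y))
      = F (z - y)" for y
    by (cases "y \<in> \<Omega>") (simp_all add: F_def q_def sgn_div_norm)
  then have "nonlocal_grad \<Omega> \<rho> u z = DIM('a) *\<^sub>R (LINT y|lebesgue. F (z - y))"
    by (simp only: nonlocal_grad_def set_lebesgue_integral_def)
  also have "\<dots> = DIM('a) *\<^sub>R (LINT w|lebesgue. F w)"
    by (simp add: lebesgue_integral_reflect)
  finally have "nonlocal_grad \<Omega> \<rho> u z - g = DIM('a) *\<^sub>R (LINT w|lebesgue. F w - E w)"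
    using F_int E_int by (simp add: E_eq scaleR_diff_right)
  moreover have "norm (LINT w|lebesgue. F w - E w)
      \<le> (LINT w|lebesgue. \<eta> * \<rho> w + (M + norm g) * (t w * \<rho> w))"
    using FE_int B_int bound by (rule Bochner_Integration.integral_norm_bound_integral)
  moreover have "\<dots> = \<eta> + (M + norm g) * (LINT w:{w. norm w > \<delta>}|lebesgue. \<rho> w)"
    using int t\<rho>_int by (simp add: mass set_lebesgue_integral_def t_def)
  ultimately show ?thesis
    by (simp add: mult_left_mono)
qed

text \<open>The evaluation points move with \<open>n\<close>, as the iterates do, so convergence at
  a fixed point would not suffice for the induction.\<close>

lemma nonlocal_grad_tendsto:
  fixes u :: "'a::euclidean_space \<Rightarrow> real" and z :: "nat \<Rightarrow> 'a"
  assumes \<Omega>: "open \<Omega>" and lip: "M-lipschitz_on \<Omega> u"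
    and der: "\<And>x. x \<in> \<Omega> \<Longrightarrow> GDERIV u x :> G x" and cont: "continuous_on \<Omega> G"
    and rad: "\<And>n. n \<ge> 1 \<Longrightarrow> radial (\<rho> n)"
    and nonneg: "\<And>n w. n \<ge> 1 \<Longrightarrow> \<rho> n w \<ge> 0"
    and int: "\<And>n. n \<ge> 1 \<Longrightarrow> integrable lebesgue (\<rho> n)"
    and mass: "\<And>n. n \<ge> 1 \<Longrightarrow> (LINT w|lebesgue. \<rho> n w) = 1"
    and conc: "\<And>\<delta>. \<delta> > 0 \<Longrightarrow> (\<lambda>n. LINT w:{w. norm w > \<delta>}|lebesgue. \<rho> n w) \<longlonglongrightarrow> 0"
    and z: "z \<longlonglongrightarrow> p" and p: "p \<in> \<Omega>"
  shows "(\<lambda>n. nonlocal_grad \<Omega> (\<rho> n) u (z n)) \<longlonglongrightarrow> G p"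
proof (rule tendstoI)
  fix e :: real assume "e > 0"
  \<comment> \<open>With this choice the error bound tends to \<open>e / 2\<close>, leaving room for
    the tail mass.\<close>
  define \<eta> where "\<eta> = e / (2 * DIM('a))"
  have \<eta>: "\<eta> > 0"
    using \<open>e > 0\<close> by (simp add: \<eta>_def)
  obtain \<delta> where "\<delta> > 0" and sub: "ball p \<delta> \<subseteq> \<Omega>"
    and lin: "\<And>x y. x \<in> ball p \<delta> \<Longrightarrow> y \<in> ball p \<delta> \<Longrightarrow>
      \<bar>u x - u y - G p \<bullet> (x - y)\<bar> \<le> \<eta> * norm (x - y)"
    using C1_strictly_differentiable[OF \<Omega> p der cont \<eta>] by metis
  \<comment> \<open>Half of \<delta> absorbs the distance from \<open>z n\<close> to
    \<open>p\<close>, the other half is a common radius for the balls around all late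
    \<open>z n\<close>.\<close>
  define r where "r = \<delta> / 2"
  have r: "r > 0"
    using \<open>\<delta> > 0\<close> by (simp add: r_def)
  let ?tail = "\<lambda>n. LINT w:{w. norm w > r}|lebesgue. \<rho> n w"
  have "(\<lambda>n. DIM('a) * (\<eta> + (M + norm (G p)) * ?tail n)) \<longlonglongrightarrow> DIM('a) * (\<eta> + (M + norm (G p)) * 0)"
    by (intro tendsto_intros conc r)
  moreover have "DIM('a) * (\<eta> + (M + norm (G p)) * 0) < e"
    using \<open>e > 0\<close> by (simp add: \<eta>_def)
  ultimately have "\<forall>\<^sub>F n in sequentially. DIM('a) * (\<eta> + (M + norm (G p)) * ?tail n) < e"
    by (rule order_tendstoD)
  moreover have "\<forall>\<^sub>F n in sequentially. dist (z n) p < r"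
    using tendstoD[OF z r] .
  ultimately show "\<forall>\<^sub>F n in sequentially. dist (nonlocal_grad \<Omega> (\<rho> n) u (z n)) (G p) < e"
    using eventually_ge_at_top[of 1]
  proof eventually_elim
    case (elim n)
    have ball: "cball (z n) r \<subseteq> ball p \<delta>"
    proof
      fix y assume "y \<in> cball (z n) r"
      then show "y \<in> ball p \<delta>"
        using elim(2) dist_triangle[of p y "z n"] by (simp add: r_def dist_commute)
    qed
    have zb: "z n \<in> ball p \<delta>"
      using elim(2) \<open>\<delta> > 0\<close> by (simp add: r_def dist_commute)
    have "norm (nonlocal_grad \<Omega> (\<rho> n) u (z n) - G p) \<le> DIM('a) * (\<eta> + (M + norm (G p)) * ?tail n)"
      using elim(3) ball sub zb \<eta>
      by (intro nonlocal_grad_error_bound[OF \<Omega> lip] rad nonneg int mass lin) auto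
    then show ?case
      using elim(1) by (simp add: dist_norm)
  qed
qed

section \<open>Convergence of the descent iterates\<close>

theorem theorem2p5:
  fixes \<Omega> :: "'a::euclidean_space set"
    and \<rho> :: "nat \<Rightarrow> 'a \<Rightarrow> real"
    and u :: "'a \<Rightarrow> real"
    and M \<epsilon> :: real
    and x0 :: 'a
    and \<alpha> :: "nat \<Rightarrow> real"
    and x :: "nat \<Rightarrow> 'a"
    and xn :: "nat \<Rightarrow> nat \<Rightarrow> 'a"
  assumes "open \<Omega>" and "bounded \<Omega>" and "connected \<Omega>" and "simply_connected \<Omega>"
    and "smooth_boundary \<Omega>" and "compact (frontier \<Omega>)"
    and "\<And>n. n \<ge> 1 \<Longrightarrow> radial (\<rho> n)"
    and "\<And>n z. n \<ge> 1 \<Longrightarrow> \<rho> n z \<ge> 0"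
    and "\<And>n. n \<ge> 1 \<Longrightarrow> integrable lebesgue (\<rho> n)"
    and "\<And>n. n \<ge> 1 \<Longrightarrow> (LINT z|lebesgue. \<rho> n z) = 1"
    and "\<And>\<delta>. \<delta> > 0 \<Longrightarrow> (\<lambda>n. LINT z:{z. norm z > \<delta>}|lebesgue. \<rho> n z) \<longlonglongrightarrow> 0"
    and "Ck_on 2 \<Omega> u" and "M-lipschitz_on \<Omega> u"
    and "\<epsilon> > 0"
    and "x0 \<in> \<Omega>"
    and "\<And>k. \<alpha> k > 0"
    and "\<And>K. K > 0 \<Longrightarrow> (\<Sum>m=1..K. \<alpha> m) < 1"
    and "x 0 = x0"
    and "\<And>k. x (Suc k) = x k - \<alpha> k *\<^sub>R grad u (x k)"
    and "\<And>n. n \<ge> 1 \<Longrightarrow> xn n 0 = x0"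
    and "\<And>n k. n \<ge> 1 \<Longrightarrow>
           xn n (Suc k) = xn n k - \<alpha> k *\<^sub>R nonlocal_grad \<Omega> (\<rho> n) u (xn n k)"
    and "\<And>k. x k \<in> \<Omega>"
    and "\<And>n k. n \<ge> 1 \<Longrightarrow> xn n k \<in> \<Omega>"
  shows "\<forall>k. \<exists>N>0. \<forall>n>N. \<forall>m\<in>{1..k+1}. norm (x m - xn n m) < \<epsilon>"
proof
  fix k
  have u: "Ck_on (Suc 1) \<Omega> u"
    using \<open>Ck_on 2 \<Omega> u\<close> by (simp only: Suc_1)
  have lim: "(\<lambda>n. xn n m) \<longlonglongrightarrow> x m" for m
  proof (induction m)
    case 0
    \<comment> \<open>Nothing is known about \<open>xn 0\<close>, so the recursion is available only
      eventually, from \<open>n = 1\<close> on.\<close>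
    have "\<forall>\<^sub>F n in sequentially. x 0 = xn n 0"
      using eventually_ge_at_top[of 1] by eventually_elim (simp add: assms)
    then show ?case
      by (rule Lim_transform_eventually[OF tendsto_const])
  next
    case (Suc m)
    \<comment> \<open>The induction hypothesis provides the moving evaluation points
      \<open>xn n m\<close>, whose limit \<open>x m\<close> lies in \<open>\<Omega>\<close>.\<close>
    have "(\<lambda>n. nonlocal_grad \<Omega> (\<rho> n) u (xn n m)) \<longlonglongrightarrow> grad u (x m)"
      by (rule nonlocal_grad_tendsto[OF \<open>open \<Omega>\<close> \<open>M-lipschitz_on \<Omega> u\<close> Ck_on_Suc_grad[OF u]])
        (use assms Suc.IH in auto)
    then have "(\<lambda>n. xn n m - \<alpha> m *\<^sub>R nonlocal_grad \<Omega> (\<rho> n) u (xn n m)) \<longlonglongrightarrow> x (Suc m)"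
      unfolding \<open>\<And>k. x (Suc k) = x k - \<alpha> k *\<^sub>R grad u (x k)\<close> by (intro tendsto_intros Suc.IH)
    moreover have "\<forall>\<^sub>F n in sequentially.
        xn n m - \<alpha> m *\<^sub>R nonlocal_grad \<Omega> (\<rho> n) u (xn n m) = xn n (Suc m)"
      using eventually_ge_at_top[of 1] by eventually_elim (simp add: assms)
    ultimately show ?case
      by (rule Lim_transform_eventually)
  qed
  \<comment> \<open>Only finitely many indices \<open>m\<close> are involved, so their thresholds
    combine into one.\<close>
  have "\<forall>\<^sub>F n in sequentially. \<forall>m\<in>{1..k+1}. dist (xn n m) (x m) < \<epsilon>"
    using tendstoD[OF lim \<open>\<epsilon> > 0\<close>] by (simp add: eventually_ball_finite_distrib)
  then obtain N where N: "\<forall>n\<ge>N. \<forall>m\<in>{1..k+1}. dist (xn n m) (x m) < \<epsilon>"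
    by (auto simp: eventually_sequentially)
  \<comment> \<open>The successor makes the threshold positive.\<close>
  have "\<forall>n>Suc N. \<forall>m\<in>{1..k+1}. norm (x m - xn n m) < \<epsilon>"
    using N by (simp add: dist_norm norm_minus_commute)
  then show "\<exists>N>0. \<forall>n>N. \<forall>m\<in>{1..k+1}. norm (x m - xn n m) < \<epsilon>"
    by blast
qed

end
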